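(* Let $R$ be a separative exchange ring in which $2$ is invertible, and let $a\in R$ be such that $a-a^3$ is regular. If $R(1-a^2)R\cap RaR=Rr(a)\cap \ell(a)R\cap RaR$, then $a$ is unit-regular.
   Context: All rings are associative with identity; modules are right modules. An element $x\in R$ is regular if $x=xyx$ for some $y\in R$, and unit-regular if $x=xux$ for some unit $u\in R$. $R$ is an exchange ring if for every $x\in R$ there is an idempotent $e\in xR$ with $1-e\in(1-x)R$. $R$ is separative if for all finitely generated projective right $R$-modules $A,B$: $A\oplus A\cong A\oplus B\cong B\oplus B$ implies $A\cong B$. $r(a)=\{x\in R: ax=0\}$, $\ell(a)=\{x\in R: xa=0\}$; $Rr(a)$, $\ell(a)R$, $R(1-a^2)R$, $RaR$ denote the two-sided ideals generated by $r(a)$, $\ell(a)$, $1-a^2$, $a$ respectively. *)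

theory Defs
  imports Main
begin

definition is_unit :: "'a::ring_1 \<Rightarrow> bool" where
  "is_unit u \<longleftrightarrow> (\<exists>v. u * v = 1 \<and> v * u = 1)"

definition regular_elt :: "'a::ring_1 \<Rightarrow> bool" where
  "regular_elt x \<longleftrightarrow> (\<exists>y. x = x * y * x)"

definition unit_regular :: "'a::ring_1 \<Rightarrow> bool" where
  "unit_regular x \<longleftrightarrow> (\<exists>u. is_unit u \<and> x = x * u * x)"

definition exchange_ring :: "'a::ring_1 itself \<Rightarrow> bool" where
  "exchange_ring _ \<longleftrightarrow> (\<forall>x::'a. \<exists>e. e * e = e \<and> (\<exists>r. e = x * r) \<and> (\<exists>s. 1 - e = (1 - x) * s))"

definition rann :: "'a::ring_1 \<Rightarrow> 'a set" where
  "rann a = {x. a * x = 0}"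

definition lann :: "'a::ring_1 \<Rightarrow> 'a set" where
  "lann a = {x. x * a = 0}"

inductive_set ideal_gen :: "'a::ring_1 set \<Rightarrow> 'a set" for S where
  zero: "0 \<in> ideal_gen S"
| gen: "s \<in> S \<Longrightarrow> x * s * y \<in> ideal_gen S"
| add: "p \<in> ideal_gen S \<Longrightarrow> q \<in> ideal_gen S \<Longrightarrow> p + q \<in> ideal_gen S"

text \<open>Every finitely generated projective right R-module is isomorphic to a direct
summand of a free module R^n; we model R^n as column vectors nat => R vanishing
from index n on, with right scalar multiplication.\<close>

definition vecs :: "nat \<Rightarrow> (nat \<Rightarrow> 'a::ring_1) set" where
  "vecs n = {v. \<forall>i\<ge>n. v i = 0}"

definition vzero :: "nat \<Rightarrow> 'a::ring_1" where
  "vzero = (\<lambda>i. 0)"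

definition vadd :: "(nat \<Rightarrow> 'a::ring_1) \<Rightarrow> (nat \<Rightarrow> 'a) \<Rightarrow> (nat \<Rightarrow> 'a)" where
  "vadd v w = (\<lambda>i. v i + w i)"

definition rsmul :: "(nat \<Rightarrow> 'a::ring_1) \<Rightarrow> 'a \<Rightarrow> (nat \<Rightarrow> 'a)" where
  "rsmul v r = (\<lambda>i. v i * r)"

definition rsubmod :: "nat \<Rightarrow> (nat \<Rightarrow> 'a::ring_1) set \<Rightarrow> bool" where
  "rsubmod n A \<longleftrightarrow> A \<subseteq> vecs n \<and> vzero \<in> A \<and> (\<forall>x\<in>A. \<forall>y\<in>A. vadd x y \<in> A)
     \<and> (\<forall>x\<in>A. \<forall>r. rsmul x r \<in> A)"

definition fg_proj :: "nat \<Rightarrow> (nat \<Rightarrow> 'a::ring_1) set \<Rightarrow> bool" where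
  "fg_proj n A \<longleftrightarrow> rsubmod n A \<and> (\<exists>B. rsubmod n B \<and> A \<inter> B = {vzero}
     \<and> (\<forall>v\<in>vecs n. \<exists>a\<in>A. \<exists>b\<in>B. v = vadd a b))"

definition mod_iso :: "(nat \<Rightarrow> 'a::ring_1) set \<Rightarrow> (nat \<Rightarrow> 'a) set \<Rightarrow> bool" where
  "mod_iso A B \<longleftrightarrow> (\<exists>f. bij_betw f A B \<and> (\<forall>x\<in>A. \<forall>y\<in>A. f (vadd x y) = vadd (f x) (f y))
     \<and> (\<forall>x\<in>A. \<forall>r. f (rsmul x r) = rsmul (f x) r))"

definition dsum :: "nat \<Rightarrow> (nat \<Rightarrow> 'a::ring_1) set \<Rightarrow> (nat \<Rightarrow> 'a) set \<Rightarrow> (nat \<Rightarrow> 'a) set" where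
  "dsum n A B = {(\<lambda>i. if i < n then a i else b (i - n)) | a b. a \<in> A \<and> b \<in> B}"

definition separative :: "'a::ring_1 itself \<Rightarrow> bool" where
  "separative _ \<longleftrightarrow> (\<forall>n m (A::(nat \<Rightarrow> 'a) set) B. fg_proj n A \<longrightarrow> fg_proj m B \<longrightarrow>
     mod_iso (dsum n A A) (dsum n A B) \<longrightarrow> mod_iso (dsum n A B) (dsum m B B) \<longrightarrow> mod_iso A B)"

end

theory Submission
  imports Defs "HOL-Library.FuncSet"
begin

text \<open>
Put \<open>b = a - a\<^sup>3 = a c\<close> with \<open>c = 1 - a\<^sup>2\<close>. Left multiplication by \<open>a\<close> maps \<open>c R\<close> into
itself; since \<open>c + a\<^sup>2 = 1\<close>, its kernel there is \<open>K = r(a)\<close>, its image is \<open>b R\<close> and its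
cokernel is \<open>Y = R / a R\<close>. As \<open>b\<close> is regular, both extensions split, so
\<open>K \<oplus> b R \<cong> c R \<cong> Y \<oplus> b R\<close>. The trace ideal of \<open>b R\<close> lies in \<open>R (1 - a\<^sup>2) R \<inter> R a R\<close>, hence by
hypothesis in the trace ideals \<open>R r(a)\<close> and \<open>\<ell>(a) R\<close> of \<open>K\<close> and \<open>Y\<close>. So \<open>b R\<close> is a direct
summand of a multiple of \<open>K\<close> and of a multiple of \<open>Y\<close>, and separativity allows \<open>b R\<close> to be
cancelled. An isomorphism \<open>K \<cong> Y\<close> means that the regular element \<open>a\<close> is unit-regular.
\<close>

section \<open>The monoid of isomorphism classes of finitely generated projective modules\<close>

text \<open>Maps are total functions on sequences, so linearity is only asked for on the module
  \<open>A\<close> itself.\<close>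

definition rlin :: "(nat \<Rightarrow> 'a::ring_1) set \<Rightarrow> ((nat \<Rightarrow> 'a) \<Rightarrow> (nat \<Rightarrow> 'a)) \<Rightarrow> bool" where
  "rlin A f \<longleftrightarrow> (\<forall>x\<in>A. \<forall>y\<in>A. f (vadd x y) = vadd (f x) (f y))
     \<and> (\<forall>x\<in>A. \<forall>r. f (rsmul x r) = rsmul (f x) r)"

text \<open>Direct sums are handled through \<open>vapp\<close>, which forms the elements of
  \<open>dsum\<close>, and \<open>vtake\<close> and \<open>vdrop\<close>, which serve as the two
  projections. \<open>vtake\<close> recovers a first block only if that block vanishes from index
  \<open>n\<close> on.\<close>

definition vtake :: "nat \<Rightarrow> (nat \<Rightarrow> 'a::ring_1) \<Rightarrow> nat \<Rightarrow> 'a" where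
  "vtake n v = (\<lambda>i. if i < n then v i else 0)"

definition vdrop :: "nat \<Rightarrow> (nat \<Rightarrow> 'a) \<Rightarrow> nat \<Rightarrow> 'a" where
  "vdrop n v = (\<lambda>i. v (i + n))"

definition vapp :: "nat \<Rightarrow> (nat \<Rightarrow> 'a) \<Rightarrow> (nat \<Rightarrow> 'a) \<Rightarrow> nat \<Rightarrow> 'a" where
  "vapp n v w = (\<lambda>i. if i < n then v i else w (i - n))"

lemma vtake_vapp: "v \<in> vecs n \<Longrightarrow> vtake n (vapp n v w) = v"
  by (auto simp: vtake_def vapp_def vecs_def fun_eq_iff)

lemma vdrop_vapp [simp]: "vdrop n (vapp n v w) = w"
  by (auto simp: vdrop_def vapp_def)

lemma vapp_vtake_vdrop [simp]: "vapp n (vtake n v) (vdrop n v) = v"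
  by (auto simp: vtake_def vdrop_def vapp_def)

lemma vtake_vecs [simp]: "vtake n v \<in> vecs n"
  by (auto simp: vtake_def vecs_def)

lemma vdrop_vecs: "v \<in> vecs (n + m) \<Longrightarrow> vdrop n v \<in> vecs m"
  by (auto simp: vdrop_def vecs_def)

lemma vapp_vecs: "w \<in> vecs m \<Longrightarrow> vapp n v w \<in> vecs (n + m)"
  by (auto simp: vapp_def vecs_def)

lemma vtake_hom:
  "vtake n (vadd v w) = vadd (vtake n v) (vtake n w)"
  "vtake n (rsmul v r) = rsmul (vtake n v) r"
  by (auto simp: vtake_def vadd_def rsmul_def)

lemma vdrop_hom:
  "vdrop n (vadd v w) = vadd (vdrop n v) (vdrop n w)"
  "vdrop n (rsmul v r) = rsmul (vdrop n v) r"
  by (auto simp: vdrop_def vadd_def rsmul_def)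

lemma vapp_hom:
  "vapp n (vadd v v') (vadd w w') = vadd (vapp n v w) (vapp n v' w')"
  "vapp n (rsmul v r) (rsmul w r) = rsmul (vapp n v w) r"
  by (auto simp: vapp_def vadd_def rsmul_def)

lemma vadd_vecs: "v \<in> vecs n \<Longrightarrow> w \<in> vecs n \<Longrightarrow> vadd v w \<in> vecs n"
  by (auto simp: vadd_def vecs_def)

lemma rsmul_vecs: "v \<in> vecs n \<Longrightarrow> rsmul v r \<in> vecs n"
  by (auto simp: rsmul_def vecs_def)

lemma mem_dsum:
  assumes "A \<subseteq> vecs n"
  shows "v \<in> dsum n A B \<longleftrightarrow> vtake n v \<in> A \<and> vdrop n v \<in> B"
proof
  assume "v \<in> dsum n A B"
  then obtain x y where v: "v = vapp n x y" and "x \<in> A" "y \<in> B"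
    by (auto simp: dsum_def vapp_def)
  moreover have "vtake n v = x"
    using assms \<open>x \<in> A\<close> v by (simp add: vtake_vapp subset_iff)
  ultimately show "vtake n v \<in> A \<and> vdrop n v \<in> B" by simp
next
  assume *: "vtake n v \<in> A \<and> vdrop n v \<in> B"
  have "v = (\<lambda>i. if i < n then vtake n v i else vdrop n v (i - n))"
    by (auto simp: vtake_def vdrop_def)
  with * show "v \<in> dsum n A B" unfolding dsum_def by blast
qed

section \<open>Linear maps and isomorphisms\<close>

lemma rlin_add: "rlin A f \<Longrightarrow> x \<in> A \<Longrightarrow> y \<in> A \<Longrightarrow> f (vadd x y) = vadd (f x) (f y)"
  and rlin_smul: "rlin A f \<Longrightarrow> x \<in> A \<Longrightarrow> f (rsmul x r) = rsmul (f x) r"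
  by (auto simp: rlin_def)

lemma rlin_subset: "rlin B f \<Longrightarrow> A \<subseteq> B \<Longrightarrow> rlin A f"
  unfolding rlin_def by blast

lemma rlin_comp: "rlin A f \<Longrightarrow> f \<in> A \<rightarrow> B \<Longrightarrow> rlin B g \<Longrightarrow> rlin A (\<lambda>x. g (f x))"
  unfolding rlin_def by (simp add: Pi_iff)

lemma rlin_vadd: "rlin A f \<Longrightarrow> rlin A g \<Longrightarrow> rlin A (\<lambda>x. vadd (f x) (g x))"
  by (auto simp: rlin_def vadd_def rsmul_def algebra_simps fun_eq_iff)

lemma mod_isoI:
  assumes "rlin A f" "f \<in> A \<rightarrow> B" "g \<in> B \<rightarrow> A"
    and "\<And>x. x \<in> A \<Longrightarrow> g (f x) = x" "\<And>y. y \<in> B \<Longrightarrow> f (g y) = y"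
  shows "mod_iso A B"
  unfolding mod_iso_def
  using assms by (intro exI [of _ f]) (auto simp: rlin_def intro!: bij_betw_byWitness [where f' = g])

text \<open>The inverse of a linear bijection is linear: closure of \<open>A\<close> puts the
  expected value of \<open>g\<close> into \<open>A\<close>, where \<open>g\<close> undoes
  \<open>f\<close>.\<close>

lemma mod_isoE:
  assumes "mod_iso A B" "rsubmod n A"
  obtains f g where "rlin A f" "rlin B g" "f \<in> A \<rightarrow> B" "g \<in> B \<rightarrow> A"
    "\<And>x. x \<in> A \<Longrightarrow> g (f x) = x" "\<And>y. y \<in> B \<Longrightarrow> f (g y) = y"
proof -
  obtain f where f: "bij_betw f A B" "rlin A f"
    using assms(1) by (auto simp: mod_iso_def rlin_def)
  define g where "g = inv_into A f"
  have gf: "\<And>x. x \<in> A \<Longrightarrow> g (f x) = x" and fg: "\<And>y. y \<in> B \<Longrightarrow> f (g y) = y"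
    and fB: "f \<in> A \<rightarrow> B" and gA: "g \<in> B \<rightarrow> A"
    using f(1) by (auto simp: g_def bij_betw_def f_inv_into_f inv_into_into)
  have "g (vadd x y) = vadd (g x) (g y)" if "x \<in> B" "y \<in> B" for x y
  proof -
    have "vadd (g x) (g y) \<in> A" using that gA assms(2) by (simp add: rsubmod_def Pi_iff)
    moreover have "f (vadd (g x) (g y)) = vadd x y"
      using that gA fg rlin_add [OF f(2)] by (simp add: Pi_iff)
    ultimately show ?thesis using gf by metis
  qed
  moreover have "g (rsmul x r) = rsmul (g x) r" if "x \<in> B" for x r
  proof -
    have "rsmul (g x) r \<in> A" using that gA assms(2) by (simp add: rsubmod_def Pi_iff)
    moreover have "f (rsmul (g x) r) = rsmul x r"
      using that gA fg rlin_smul [OF f(2)] by (simp add: Pi_iff)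
    ultimately show ?thesis using gf by metis
  qed
  ultimately have "rlin B g" by (auto simp: rlin_def)
  with that f(2) fB gA gf fg show thesis by blast
qed

lemma mod_iso_refl: "mod_iso A A"
  by (rule mod_isoI [where f = "\<lambda>x. x" and g = "\<lambda>x. x"]) (auto simp: rlin_def)

lemma mod_iso_sym: "mod_iso A B \<Longrightarrow> rsubmod n A \<Longrightarrow> mod_iso B A"
  by (erule (1) mod_isoE, rule mod_isoI) assumption+

lemma mod_iso_trans:
  assumes "mod_iso A B" "mod_iso B C"
  shows "mod_iso A C"
proof -
  obtain f g where f: "bij_betw f A B" "rlin A f" and g: "bij_betw g B C" "rlin B g"
    using assms unfolding mod_iso_def rlin_def by blast
  have "f \<in> A \<rightarrow> B" using f(1) by (auto simp: bij_betw_def)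
  then have "rlin A (\<lambda>x. g (f x))" using rlin_comp f(2) g(2) by blast
  moreover have "bij_betw (\<lambda>x. g (f x)) A C"
    using bij_betw_trans [OF f(1) g(1)] by (simp add: comp_def)
  ultimately show ?thesis unfolding mod_iso_def rlin_def by blast
qed

section \<open>Projective modules as retracts of free modules\<close>

lemma rsubmod_vecs: "rsubmod n A \<Longrightarrow> A \<subseteq> vecs n"
  by (simp add: rsubmod_def)

text \<open>The kernel of the projection \<open>p\<close> is a complement of \<open>A\<close>, by
  the splitting v = p v + (v - p v).\<close>

lemma fg_projI:
  assumes p: "rlin (vecs n) p" "p \<in> vecs n \<rightarrow> A" and A: "A \<subseteq> vecs n" "\<And>x. x \<in> A \<Longrightarrow> p x = x"
  shows "fg_proj n A"
proof -
  define B where "B = {v \<in> vecs n. p v = vzero}"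
  have p0: "p vzero = vzero"
    using rlin_smul [OF p(1), of vzero 0] by (auto simp: vecs_def vzero_def rsmul_def)
  have z: "vzero \<in> vecs n" by (simp add: vecs_def vzero_def)
  have "rsubmod n A"
    unfolding rsubmod_def
  proof (intro conjI ballI allI)
    show "vzero \<in> A" using p p0 z by (metis PiE)
    show "vadd x y \<in> A" if "x \<in> A" "y \<in> A" for x y
      using that rlin_add [OF p(1), of x y] p(2) A vadd_vecs [of x n y]
      by (metis PiE subsetD)
    show "rsmul x r \<in> A" if "x \<in> A" for x r
      using that rlin_smul [OF p(1), of x r] p(2) A rsmul_vecs [of x n r]
      by (metis PiE subsetD)
  qed (use A in auto)
  moreover have "rsubmod n B"
    using p0 z rlin_add [OF p(1)] rlin_smul [OF p(1)]
    by (auto simp: rsubmod_def B_def vadd_vecs rsmul_vecs) (auto simp: vzero_def vadd_def rsmul_def)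
  moreover have "A \<inter> B = {vzero}"
    using A p0 z \<open>rsubmod n A\<close> by (auto simp: B_def rsubmod_def)
  moreover have "\<exists>x\<in>A. \<exists>y\<in>B. v = vadd x y" if v: "v \<in> vecs n" for v
  proof (intro bexI)
    let ?y = "vadd v (rsmul (p v) (- 1))"
    have pv: "p v \<in> A" "p v \<in> vecs n" using p(2) A v by auto
    show "v = vadd (p v) ?y" by (auto simp: vadd_def rsmul_def)
    have "p ?y = vadd (p v) (rsmul (p (p v)) (- 1))"
      using v pv by (simp add: rlin_add [OF p(1)] rlin_smul [OF p(1)] rsmul_vecs)
    also have "\<dots> = vzero" using pv A by (auto simp: vadd_def rsmul_def vzero_def)
    finally show "?y \<in> B" using v pv by (auto simp: B_def vadd_vecs rsmul_vecs)
    show "p v \<in> A" by fact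
  qed
  ultimately show ?thesis unfolding fg_proj_def by blast
qed

text \<open>Take the projection along a complement; it is linear because the decomposition of a
  vector is unique.\<close>

lemma fg_projE:
  assumes "fg_proj n A"
  obtains p where "rlin (vecs n) p" "p \<in> vecs n \<rightarrow> A" "rsubmod n A" "\<And>x. x \<in> A \<Longrightarrow> p x = x"
proof -
  obtain B where A: "rsubmod n A" and B: "rsubmod n B" and AB: "A \<inter> B = {vzero}"
    and ex: "\<And>v. v \<in> vecs n \<Longrightarrow> \<exists>x\<in>A. \<exists>y\<in>B. v = vadd x y"
    using assms unfolding fg_proj_def by blast
  obtain p q where pq: "\<And>v. v \<in> vecs n \<Longrightarrow> p v \<in> A \<and> q v \<in> B \<and> v = vadd (p v) (q v)"
    using ex by metis
  have uniq: "x = x'" if "x \<in> A" "x' \<in> A" "y \<in> B" "y' \<in> B" "vadd x y = vadd x' y'" for x x' y y'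
  proof -
    \<comment> \<open>The differences x - x' in \<open>A\<close> and y' - y in \<open>B\<close>
      agree, hence lie in the zero intersection.\<close>
    let ?d = "vadd x (rsmul x' (- 1))" and ?e = "vadd y' (rsmul y (- 1))"
    have "?d \<in> A" "?e \<in> B" using that A B by (auto simp: rsubmod_def)
    moreover have "?d = ?e"
      using that(5) by (auto simp: vadd_def rsmul_def fun_eq_iff algebra_simps)
    ultimately have "?d = vzero" using AB by auto
    then show ?thesis by (auto simp: vadd_def rsmul_def vzero_def fun_eq_iff)
  qed
  have pq': "p v \<in> A" "q v \<in> B" "vadd (p v) (q v) = v" if "v \<in> vecs n" for v
    using pq [OF that] by simp_all
  have AB_closed: "\<And>x y. x \<in> A \<Longrightarrow> y \<in> A \<Longrightarrow> vadd x y \<in> A" "\<And>x r. x \<in> A \<Longrightarrow> rsmul x r \<in> A"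
    "\<And>x y. x \<in> B \<Longrightarrow> y \<in> B \<Longrightarrow> vadd x y \<in> B" "\<And>x r. x \<in> B \<Longrightarrow> rsmul x r \<in> B"
    using A B by (simp_all add: rsubmod_def)
  have "p (vadd v w) = vadd (p v) (p w)" if "v \<in> vecs n" "w \<in> vecs n" for v w
  proof (rule uniq)
    have "vadd (vadd (p v) (p w)) (vadd (q v) (q w)) = vadd (vadd (p v) (q v)) (vadd (p w) (q w))"
      by (simp add: vadd_def fun_eq_iff algebra_simps)
    then show "vadd (p (vadd v w)) (q (vadd v w)) = vadd (vadd (p v) (p w)) (vadd (q v) (q w))"
      using that by (simp add: pq' vadd_vecs)
  qed (use that AB_closed in \<open>simp_all add: pq' vadd_vecs\<close>)
  moreover have "p (rsmul v r) = rsmul (p v) r" if "v \<in> vecs n" for v r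
  proof (rule uniq)
    have "vadd (rsmul (p v) r) (rsmul (q v) r) = rsmul (vadd (p v) (q v)) r"
      by (simp add: vadd_def rsmul_def fun_eq_iff algebra_simps)
    then show "vadd (p (rsmul v r)) (q (rsmul v r)) = vadd (rsmul (p v) r) (rsmul (q v) r)"
      using that by (simp add: pq' rsmul_vecs)
  qed (use that AB_closed in \<open>simp_all add: pq' rsmul_vecs\<close>)
  ultimately have "rlin (vecs n) p" by (simp add: rlin_def)
  moreover have "p x = x" if "x \<in> A" for x
  proof (rule uniq)
    have x: "x \<in> vecs n" using that A by (auto simp: rsubmod_def)
    show "p x \<in> A" "q x \<in> B" using pq' x by simp_all
    show "vzero \<in> B" using B by (simp add: rsubmod_def)
    have "vadd x vzero = x" by (simp add: vadd_def vzero_def)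
    then show "vadd (p x) (q x) = vadd x vzero" using pq' x by simp
  qed (rule that)
  ultimately show thesis using that pq'(1) A by blast
qed

lemma fg_proj_rsubmod: "fg_proj n A \<Longrightarrow> rsubmod n A"
  by (simp add: fg_proj_def)

lemma fg_proj_vecs: "fg_proj n A \<Longrightarrow> A \<subseteq> vecs n"
  by (simp add: fg_proj_def rsubmod_def)

section \<open>Direct sums\<close>

lemma fg_proj_dsum:
  assumes "fg_proj n A" "fg_proj m B"
  shows "fg_proj (n + m) (dsum n A B)"
proof -
  obtain p where p: "rlin (vecs n) p" "p \<in> vecs n \<rightarrow> A" "rsubmod n A" "\<And>x. x \<in> A \<Longrightarrow> p x = x"
    using assms(1) by (rule fg_projE) blast
  obtain q where q: "rlin (vecs m) q" "q \<in> vecs m \<rightarrow> B" "rsubmod m B" "\<And>x. x \<in> B \<Longrightarrow> q x = x"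
    using assms(2) by (rule fg_projE) blast
  note A = fg_proj_vecs [OF assms(1)] and B = fg_proj_vecs [OF assms(2)]
  show ?thesis
  proof (rule fg_projI [where p = "\<lambda>v. vapp n (p (vtake n v)) (q (vdrop n v))"])
    show "rlin (vecs (n + m)) (\<lambda>v. vapp n (p (vtake n v)) (q (vdrop n v)))"
      using rlin_add [OF p(1)] rlin_smul [OF p(1)] rlin_add [OF q(1)] rlin_smul [OF q(1)]
      by (auto simp: rlin_def vtake_hom vdrop_hom vdrop_vecs vapp_hom)
    have "vapp n (p (vtake n v)) (q (vdrop n v)) \<in> dsum n A B" if "v \<in> vecs (n + m)" for v
    proof -
      have "p (vtake n v) \<in> A" "q (vdrop n v) \<in> B" using p(2) q(2) vdrop_vecs [OF that] by auto
      then show ?thesis using A by (auto simp: mem_dsum vtake_vapp subset_iff)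
    qed
    then show "(\<lambda>v. vapp n (p (vtake n v)) (q (vdrop n v))) \<in> vecs (n + m) \<rightarrow> dsum n A B"
      by blast
    show "dsum n A B \<subseteq> vecs (n + m)"
    proof
      fix v assume "v \<in> dsum n A B"
      then have "vdrop n v \<in> vecs m" using A B by (auto simp: mem_dsum)
      then show "v \<in> vecs (n + m)" by (metis vapp_vecs vapp_vtake_vdrop)
    qed
  qed (use A p(4) q(4) in \<open>auto simp: mem_dsum\<close>)
qed

lemma mod_iso_dsum_cong:
  assumes "mod_iso A A'" "mod_iso B B'" "rsubmod n A" "rsubmod n' A'" "rsubmod m B"
  shows "mod_iso (dsum n A B) (dsum n' A' B')"
proof -
  obtain f f' where f: "rlin A f" "rlin A' f'" "f \<in> A \<rightarrow> A'" "f' \<in> A' \<rightarrow> A"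
    "\<And>x. x \<in> A \<Longrightarrow> f' (f x) = x" "\<And>y. y \<in> A' \<Longrightarrow> f (f' y) = y"
    using assms(1,3) by (rule mod_isoE) blast
  obtain g g' where g: "rlin B g" "rlin B' g'" "g \<in> B \<rightarrow> B'" "g' \<in> B' \<rightarrow> B"
    "\<And>x. x \<in> B \<Longrightarrow> g' (g x) = x" "\<And>y. y \<in> B' \<Longrightarrow> g (g' y) = y"
    using assms(2,5) by (rule mod_isoE) blast
  note A = rsubmod_vecs [OF assms(3)] and A' = rsubmod_vecs [OF assms(4)]
  have 1: "vtake n' (vapp n' (f x) w) = f x" if "x \<in> A" for x w
    using that f(3) A' by (auto intro!: vtake_vapp)
  have 2: "vtake n (vapp n (f' x) w) = f' x" if "x \<in> A'" for x w
    using that f(4) A by (auto intro!: vtake_vapp)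
  show ?thesis
  proof (rule mod_isoI [where f = "\<lambda>v. vapp n' (f (vtake n v)) (g (vdrop n v))"
        and g = "\<lambda>v. vapp n (f' (vtake n' v)) (g' (vdrop n' v))"])
    show "rlin (dsum n A B) (\<lambda>v. vapp n' (f (vtake n v)) (g (vdrop n v)))"
      using rlin_add [OF f(1)] rlin_smul [OF f(1)] rlin_add [OF g(1)] rlin_smul [OF g(1)]
      by (auto simp: rlin_def vtake_hom vdrop_hom vapp_hom mem_dsum [OF A])
  qed (use f(3-) g(3-) in \<open>auto simp: mem_dsum [OF A] mem_dsum [OF A'] 1 2\<close>)
qed

lemma mod_iso_dsum_comm:
  assumes "A \<subseteq> vecs n" "B \<subseteq> vecs m"
  shows "mod_iso (dsum n A B) (dsum m B A)"
proof (rule mod_isoI [where f = "\<lambda>v. vapp m (vdrop n v) (vtake n v)"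
      and g = "\<lambda>v. vapp n (vdrop m v) (vtake m v)"])
  show "rlin (dsum n A B) (\<lambda>v. vapp m (vdrop n v) (vtake n v))"
    by (auto simp: rlin_def vtake_hom vdrop_hom vapp_hom)
qed (use assms in \<open>auto simp: mem_dsum [OF assms(1)] mem_dsum [OF assms(2)] vtake_vapp subset_iff\<close>)

text \<open>Concatenation of coordinates is strictly associative, so there is an equality of sets
  and not merely an isomorphism.\<close>

lemma dsum_assoc:
  assumes "A \<subseteq> vecs n" "B \<subseteq> vecs m"
  shows "dsum (n + m) (dsum n A B) C = dsum n A (dsum m B C)"
proof -
  have *: "dsum n A B \<subseteq> vecs (n + m)"
  proof
    fix v assume "v \<in> dsum n A B"
    then have "vdrop n v \<in> vecs m" using assms by (auto simp: mem_dsum)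
    then show "v \<in> vecs (n + m)" by (metis vapp_vecs vapp_vtake_vdrop)
  qed
  have "vtake n (vtake (n + m) v) = vtake n v" "vdrop n (vtake (n + m) v) = vtake m (vdrop n v)"
    "vdrop (n + m) v = vdrop m (vdrop n v)" for v :: "nat \<Rightarrow> 'a"
    by (auto simp: vtake_def vdrop_def algebra_simps)
  then show ?thesis
    by (auto simp: mem_dsum [OF *] mem_dsum [OF assms(1)] mem_dsum [OF assms(2)])
qed

lemma dsum_vecs_0: "dsum 0 (vecs 0) A = A"
proof -
  have "vecs 0 = {\<lambda>i. 0 :: 'a}" by (auto simp: vecs_def)
  then show ?thesis by (auto simp: dsum_def)
qed

section \<open>The monoid of classes as a quotient type\<close>

lemma fg_proj_vecs_self: "fg_proj n (vecs n)"
  by (rule fg_projI [where p = "\<lambda>x. x"]) (auto simp: rlin_def)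

text \<open>The length \<open>n\<close> is kept with the module because \<open>dsum\<close> needs to
  know where the second block starts. The relation is reflexive on projective modules only, which
  makes the quotient partial.\<close>

definition same_class :: "nat \<times> (nat \<Rightarrow> 'a::ring_1) set \<Rightarrow> nat \<times> (nat \<Rightarrow> 'a) set \<Rightarrow> bool" where
  "same_class = (\<lambda>(n, A) (m, B). fg_proj n A \<and> fg_proj m B \<and> mod_iso A B)"

quotient_type (overloaded) 'a proj_class = "nat \<times> (nat \<Rightarrow> 'a::ring_1) set" / partial: same_class
proof (rule part_equivpI)
  show "\<exists>x :: nat \<times> (nat \<Rightarrow> 'a) set. same_class x x"
    by (rule exI [of _ "(0, vecs 0)"]) (simp add: same_class_def fg_proj_vecs_self mod_iso_refl)
  show "symp (same_class :: nat \<times> (nat \<Rightarrow> 'a) set \<Rightarrow> _)"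
    by (auto simp: symp_def same_class_def intro: mod_iso_sym fg_proj_rsubmod)
  show "transp (same_class :: nat \<times> (nat \<Rightarrow> 'a) set \<Rightarrow> _)"
    by (auto simp: transp_def same_class_def intro: mod_iso_trans)
qed

instantiation proj_class :: (ring_1) comm_monoid_add
begin

lift_definition zero_proj_class :: "'a proj_class" is "(0, vecs 0)"
  by (simp add: same_class_def fg_proj_vecs_self mod_iso_refl)

lift_definition plus_proj_class :: "'a proj_class \<Rightarrow> 'a proj_class \<Rightarrow> 'a proj_class"
  is "\<lambda>(n, A) (m, B). (n + m, dsum n A B)"
  by (auto simp: same_class_def fg_proj_dsum intro: mod_iso_dsum_cong fg_proj_rsubmod)

instance
proof
  fix a b c :: "'a proj_class"
  show "a + b + c = a + (b + c)"
  proof (transfer, clarsimp simp: same_class_def)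
    fix n m l and A B C :: "(nat \<Rightarrow> 'a) set"
    assume "fg_proj n A" "fg_proj m B" "fg_proj l C"
    then show "fg_proj (n + m + l) (dsum (n + m) (dsum n A B) C)
        \<and> fg_proj (n + (m + l)) (dsum n A (dsum m B C))
        \<and> mod_iso (dsum (n + m) (dsum n A B) C) (dsum n A (dsum m B C))"
      by (simp add: dsum_assoc fg_proj_vecs mod_iso_refl fg_proj_dsum add.assoc)
  qed
  show "a + b = b + a"
    by transfer (auto simp: same_class_def fg_proj_vecs mod_iso_dsum_comm fg_proj_dsum)
  show "0 + a = a"
    by transfer (auto simp: same_class_def dsum_vecs_0)
qed

end

definition vcls :: "nat \<Rightarrow> (nat \<Rightarrow> 'a::ring_1) set \<Rightarrow> 'a proj_class" where
  "vcls n A = abs_proj_class (n, A)"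

lemma vcls_eq_iff:
  assumes "fg_proj n A" "fg_proj m B"
  shows "vcls n A = vcls m B \<longleftrightarrow> mod_iso A B"
  using Quotient3_rel [OF Quotient3_proj_class, of "(n, A)" "(m, B)"] assms
  by (simp add: vcls_def same_class_def mod_iso_refl)

lemma vcls_cases:
  obtains n A where "x = vcls n A" "fg_proj n A"
proof -
  obtain n A where nA: "rep_proj_class x = (n, A)" by (cases "rep_proj_class x")
  have "x = vcls n A"
    using Quotient3_abs_rep [OF Quotient3_proj_class, of x] by (simp add: vcls_def nA)
  moreover have "fg_proj n A"
    using Quotient3_rep_reflp [OF Quotient3_proj_class, of x] by (simp add: nA same_class_def)
  ultimately show thesis by (rule that)
qed

lemma vcls_add:
  assumes "fg_proj n A" "fg_proj m B"
  shows "vcls n A + vcls m B = vcls (n + m) (dsum n A B)"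
  using assms unfolding vcls_def
  by (subst plus_proj_class.abs_eq) (auto simp: same_class_def mod_iso_refl)

lemma vcls_0: "vcls 0 (vecs 0) = 0"
  by (simp add: vcls_def zero_proj_class_def)

section \<open>Separativity and cancellation\<close>

lemma separative_proj_class:
  fixes x y :: "'a::ring_1 proj_class"
  assumes "separative TYPE('a)" "x + x = x + y" "x + y = y + y"
  shows "x = y"
proof -
  obtain n A where x: "x = vcls n A" "fg_proj n A" by (rule vcls_cases)
  obtain m B where y: "y = vcls m B" "fg_proj m B" by (rule vcls_cases)
  have "mod_iso (dsum n A A) (dsum n A B)" "mod_iso (dsum n A B) (dsum m B B)"
    using assms(2,3) x y by (simp_all add: vcls_add vcls_eq_iff fg_proj_dsum)
  then have "mod_iso A B"
    using assms(1) x y unfolding separative_def by blast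
  with x y show ?thesis by (simp add: vcls_eq_iff)
qed

lemma separative_cancel:
  fixes a b c d e :: "'b::comm_monoid_add"
  assumes sep: "\<And>x y :: 'b. x + x = x + y \<Longrightarrow> x + y = y + y \<Longrightarrow> x = y"
    and abc: "a + c = b + c"
    and cd: "c + d = sum_list (replicate n a)"
    and ce: "c + e = sum_list (replicate m b)"
  shows "a = b"
proof -
  txt \<open>All words of length \<open>k \<ge> n + m\<close> in \<open>a\<close>, \<open>b\<close> have the same sum. If this holds for all lengths
    above \<open>N \<ge> 1\<close>, it holds for \<open>N\<close>: separativity applies, as two words of length \<open>N\<close> add up to
    one of length \<open>2 N > N\<close>.\<close>
  define w where "w i j = sum_list (replicate i a) + sum_list (replicate j b)" for i j
  have w_add: "w i j + w i' j' = w (i + i') (j + j')" for i j i' j'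
    by (simp add: w_def replicate_add ac_simps)
  \<comment> \<open>The word \<open>w n 0\<close> equals \<open>c + d\<close>, so it absorbs the
    summand \<open>c\<close> needed to exchange \<open>a\<close> for \<open>b\<close>.\<close>
  have "w n 0 + a = w n 0 + b"
    using abc by (simp add: w_def flip: cd) (metis add.assoc add.commute)
  moreover have "w 1 0 = a" "w 0 1 = b" by (simp_all add: w_def)
  ultimately have wn: "w (Suc n) 0 = w n 1"
    using w_add [of n 0 1 0] w_add [of n 0 0 1] by simp
  have "w 0 m + a = w 0 m + b"
    using abc by (simp add: w_def flip: ce) (metis add.assoc add.commute)
  with \<open>w 1 0 = a\<close> \<open>w 0 1 = b\<close> have wm: "w 1 m = w 0 (Suc m)"
    using w_add [of 0 m 1 0] w_add [of 0 m 0 1] by simp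
  \<comment> \<open>Next to \<open>n\<close> copies of \<open>a\<close>, every \<open>b\<close> can
    be turned into an \<open>a\<close>; in \<open>B\<close> below, \<open>m\<close> copies of
    \<open>b\<close> play the symmetric role.\<close>
  have A: "w (n + i) j = w (n + i + j) 0" for i j
  proof (induction j arbitrary: i)
    case (Suc j)
    have "w (n + i) (Suc j) = w n 1 + w i j" by (simp add: w_add)
    also have "\<dots> = w (n + Suc i) j" unfolding wn [symmetric] w_add by simp
    finally show ?case using Suc [of "Suc i"] by simp
  qed simp
  have B: "w i (m + j) = w 0 (i + m + j)" for i j
  proof (induction i arbitrary: j)
    case (Suc i)
    have "w (Suc i) (m + j) = w 1 m + w i j" by (simp add: w_add)
    also have "\<dots> = w i (m + Suc j)" unfolding wm w_add by simp
    finally show ?case using Suc [of "Suc j"] by simp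
  qed simp
  define H where "H k \<longleftrightarrow> (\<forall>i j i' j'. i + j = k \<longrightarrow> i' + j' = k \<longrightarrow> w i j = w i' j')" for k
  have HD: "w i j = w i' j'" if "H k" "i + j = k" "i' + j' = k" for i j i' j' k
    using that unfolding H_def by blast
  have "H k" if k: "n + m \<le> k" for k
  proof -
    have k0: "w k 0 = w 0 k"
    proof -
      \<comment> \<open>The word with \<open>n\<close> copies of \<open>a\<close> and
        \<open>k - n \<ge> m\<close> copies of \<open>b\<close> is covered by both \<open>A\<close>
        and \<open>B\<close>, so it links the two pure words.\<close>
      have "w k 0 = w n (k - n)" using A [of 0 "k - n"] k by simp
      also have "\<dots> = w 0 k" using B [of n "k - n - m"] k by simp
      finally show ?thesis .
    qed
    have "w i j = w k 0" if "i + j = k" for i j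
    proof (cases "n \<le> i")
      case True
      then show ?thesis using A [of "i - n" j] that by simp
    next
      case False
      then have "m \<le> j" using that k by simp
      then have "w i j = w 0 k" using B [of i "j - m"] that by simp
      then show ?thesis using k0 by simp
    qed
    then show ?thesis unfolding H_def by metis
  qed
  then have base: "\<forall>k\<ge>n + m. 1 \<le> k \<longrightarrow> H k" by simp
  \<comment> \<open>Downward induction from \<open>n + m\<close>. The guard \<open>1 \<le> k\<close>
    is there because \<open>N + N\<close> exceeds \<open>N\<close> only for positive
    \<open>N\<close>.\<close>
  have "\<forall>k\<ge>0. 1 \<le> k \<longrightarrow> H k"
  proof (rule inc_induct [of 0 "n + m"])
    fix N assume IH: "\<forall>k\<ge>Suc N. 1 \<le> k \<longrightarrow> H k"
    have "H N" if "1 \<le> N"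
      unfolding H_def
    proof (intro allI impI)
      fix i j i' j' assume ij: "i + j = N" "i' + j' = N"
      have *: "H (N + N)" using IH that by simp
      show "w i j = w i' j'"
      proof (rule sep)
        show "w i j + w i j = w i j + w i' j'"
          unfolding w_add by (rule HD [OF *]) (use ij in simp_all)
        show "w i j + w i' j' = w i' j' + w i' j'"
          unfolding w_add by (rule HD [OF *]) (use ij in simp_all)
      qed
    qed
    then show "\<forall>k\<ge>N. 1 \<le> k \<longrightarrow> H k" using IH by (metis not_less_eq_eq le_antisym)
  qed (use base in simp_all)
  then have "H 1" by simp
  then have "w 1 0 = w 0 1" by (rule HD) simp_all
  then show ?thesis by (simp add: w_def)
qed

text \<open>The idempotent endomorphism \<open>f g\<close> splits \<open>C\<close>. The complement
  of the image of \<open>A\<close> is the kernel \<open>D\<close> of \<open>g\<close>, and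
  \<open>r = 1 - f g\<close> projects onto it; composing \<open>r\<close> with a projection onto
  \<open>C\<close> shows that \<open>D\<close> is projective.\<close>

lemma vcls_retract:
  assumes A: "fg_proj n A" and C: "fg_proj m C"
    and f: "rlin A f" "f \<in> A \<rightarrow> C" and g: "rlin C g" "g \<in> C \<rightarrow> A"
    and gf: "\<And>x. x \<in> A \<Longrightarrow> g (f x) = x"
  shows "\<exists>d. vcls n A + d = vcls m C"
proof -
  obtain p where p: "rlin (vecs m) p" "p \<in> vecs m \<rightarrow> C" "rsubmod m C" "\<And>x. x \<in> C \<Longrightarrow> p x = x"
    using C by (rule fg_projE) blast
  have A0: "vzero \<in> A" and Avec: "A \<subseteq> vecs n" using A by (auto simp: fg_proj_def rsubmod_def)
  have Cvec: "\<And>x. x \<in> C \<Longrightarrow> x \<in> vecs m" using p(3) by (auto simp: rsubmod_def)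
  have C_closed: "\<And>x y. x \<in> C \<Longrightarrow> y \<in> C \<Longrightarrow> vadd x y \<in> C" "\<And>x r. x \<in> C \<Longrightarrow> rsmul x r \<in> C"
    using p(3) by (simp_all add: rsubmod_def)
  have fC: "\<And>x. x \<in> A \<Longrightarrow> f x \<in> C" and gA: "\<And>x. x \<in> C \<Longrightarrow> g x \<in> A" using f(2) g(2) by auto
  have f0: "f vzero = vzero"
    using rlin_smul [OF f(1) A0, of 0] by (simp add: rsmul_def vzero_def)
  define D where "D = {x \<in> C. g x = vzero}"
  define r where "r x = vadd x (rsmul (f (g x)) (- 1))" for x
  have r_lin: "rlin C r"
    unfolding r_def rlin_def
    by (simp add: rlin_add [OF g(1)] rlin_smul [OF g(1)] rlin_add [OF f(1)] rlin_smul [OF f(1)] gA)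
      (simp add: vadd_def rsmul_def fun_eq_iff algebra_simps)
  have r_D: "r x \<in> D" if "x \<in> C" for x
  proof -
    have "g (r x) = vadd (g x) (rsmul (g x) (- 1))"
      using that by (simp add: r_def rlin_add [OF g(1)] rlin_smul [OF g(1)] fC gA C_closed gf)
    also have "\<dots> = vzero" by (simp add: vadd_def rsmul_def vzero_def)
    finally show ?thesis using that by (simp add: D_def r_def C_closed fC gA)
  qed
  have r_id: "r x = x" if "x \<in> D" for x
    using that f0 by (simp add: D_def r_def) (simp add: vadd_def rsmul_def vzero_def)
  have "fg_proj m D"
  proof (rule fg_projI [where p = "\<lambda>x. r (p x)"])
    show "rlin (vecs m) (\<lambda>x. r (p x))" using rlin_comp p r_lin by blast
    show "(\<lambda>x. r (p x)) \<in> vecs m \<rightarrow> D" using p(2) r_D by auto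
  qed (use Cvec p(4) r_id in \<open>auto simp: D_def\<close>)
  moreover have "mod_iso C (dsum n A D)"
  proof (rule mod_isoI [where f = "\<lambda>x. vapp n (g x) (r x)" and g = "\<lambda>x. vadd (f (vtake n x)) (vdrop n x)"])
    show "rlin C (\<lambda>x. vapp n (g x) (r x))"
      unfolding rlin_def
      by (simp add: rlin_add [OF g(1)] rlin_smul [OF g(1)] rlin_add [OF r_lin] rlin_smul [OF r_lin] vapp_hom)
    have t: "vtake n (vapp n (g x) y) = g x" if "x \<in> C" for x y
      using gA [OF that] Avec by (auto intro: vtake_vapp)
    then show "(\<lambda>x. vapp n (g x) (r x)) \<in> C \<rightarrow> dsum n A D"
      using gA r_D by (simp add: mem_dsum [OF Avec])
    show "(\<lambda>x. vadd (f (vtake n x)) (vdrop n x)) \<in> dsum n A D \<rightarrow> C"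
      using fC C_closed by (simp add: mem_dsum [OF Avec] D_def)
    show "vadd (f (vtake n (vapp n (g x) (r x)))) (vdrop n (vapp n (g x) (r x))) = x" if "x \<in> C" for x
      using that by (simp add: t r_def) (simp add: vadd_def rsmul_def)
    fix u assume "u \<in> dsum n A D"
    then have u: "vtake n u \<in> A" "vdrop n u \<in> C" "g (vdrop n u) = vzero"
      by (simp_all add: mem_dsum [OF Avec] D_def)
    have gu: "g (vadd (f (vtake n u)) (vdrop n u)) = vtake n u"
      using u by (simp add: rlin_add [OF g(1)] fC gf) (simp add: vadd_def vzero_def)
    then have "r (vadd (f (vtake n u)) (vdrop n u)) = vdrop n u"
      by (simp add: r_def) (simp add: vadd_def rsmul_def)
    with gu show "vapp n (g (vadd (f (vtake n u)) (vdrop n u))) (r (vadd (f (vtake n u)) (vdrop n u))) = u"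
      by simp
  qed
  ultimately have "vcls n A + vcls m D = vcls m C"
    using A C by (simp add: vcls_add vcls_eq_iff fg_proj_dsum)
      (metis fg_proj_rsubmod mod_iso_sym)
  then show ?thesis by blast
qed

section \<open>Classes of idempotents\<close>

declare One_nat_def [simp del]

definition single :: "'a::ring_1 \<Rightarrow> nat \<Rightarrow> 'a" where
  "single r = (\<lambda>i. if i = 0 then r else 0)"

definition lmul :: "'a::ring_1 \<Rightarrow> (nat \<Rightarrow> 'a) \<Rightarrow> nat \<Rightarrow> 'a" where
  "lmul x v = single (x * v 0)"

text \<open>For an idempotent \<open>e\<close> this is the right ideal \<open>e R\<close>, placed
  inside the free module of rank one. Left multiplications \<open>lmul\<close> are the maps between
  such modules.\<close>

definition pmod :: "'a::ring_1 \<Rightarrow> (nat \<Rightarrow> 'a) set" where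
  "pmod e = {v \<in> vecs 1. e * v 0 = v 0}"

abbreviation idem_class :: "'a::ring_1 \<Rightarrow> 'a proj_class" where
  "idem_class e \<equiv> vcls 1 (pmod e)"

lemma single_0 [simp]: "single r 0 = r"
  by (simp add: single_def)

lemma single_vecs [simp]: "single r \<in> vecs 1"
  by (simp add: single_def vecs_def)

lemma single_id: "v \<in> vecs 1 \<Longrightarrow> single (v 0) = v"
  by (auto simp: single_def vecs_def fun_eq_iff)

lemma lmul_0 [simp]: "lmul x v 0 = x * v 0"
  by (simp add: lmul_def)

lemma lmul_vecs [simp]: "lmul x v \<in> vecs 1"
  by (simp add: lmul_def)

lemma lmul_lmul [simp]: "lmul x (lmul y v) = lmul (x * y) v"
  by (simp add: lmul_def mult.assoc)

lemma rlin_lmul: "rlin A (lmul x)"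
  by (auto simp: rlin_def lmul_def single_def vadd_def rsmul_def fun_eq_iff algebra_simps)

lemma lmul_add_left: "lmul (x + y) v = vadd (lmul x v) (lmul y v)"
  by (auto simp: lmul_def single_def vadd_def algebra_simps)

lemma pmod_vecs: "pmod e \<subseteq> vecs 1"
  by (auto simp: pmod_def)

lemma lmul_pmod: "v \<in> pmod e \<Longrightarrow> lmul e v = v"
  by (simp add: lmul_def pmod_def single_id)

lemma lmul_in_pmod: "e * x = x \<Longrightarrow> lmul x v \<in> pmod e"
  by (simp add: pmod_def flip: mult.assoc)

lemma fg_proj_pmod: "e * e = e \<Longrightarrow> fg_proj 1 (pmod e)"
  by (rule fg_projI [where p = "lmul e"]) (auto simp: rlin_lmul lmul_in_pmod lmul_pmod pmod_vecs)

text \<open>Left multiplications by \<open>x\<close> and by \<open>y\<close> are mutually inverse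
  between the two right ideals.\<close>

lemma idem_class_eqI:
  fixes x y :: "'a::ring_1"
  assumes "(y * x) * (y * x) = y * x" "(x * y) * (x * y) = x * y"
  shows "idem_class (y * x) = idem_class (x * y)"
proof -
  have "mod_iso (pmod (y * x)) (pmod (x * y))"
  proof (rule mod_isoI [where f = "lmul x" and g = "lmul y"])
    show "lmul x \<in> pmod (y * x) \<rightarrow> pmod (x * y)"
      by (auto simp: pmod_def mult.assoc)
    show "lmul y \<in> pmod (x * y) \<rightarrow> pmod (y * x)"
      by (auto simp: pmod_def mult.assoc)
  qed (auto simp: rlin_lmul lmul_pmod)
  then show ?thesis using assms by (simp add: vcls_eq_iff fg_proj_pmod)
qed

text \<open>Orthogonality makes (e + f) R the direct sum of e R and f R: a vector v goes to the pair
  (e v, f v), and addition is the inverse.\<close>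

lemma idem_class_add:
  assumes e: "e * e = e" and f: "f * f = f" and ef: "e * f = 0" "f * e = 0"
  shows "idem_class (e + f) = idem_class e + idem_class f"
proof -
  have idem: "(e + f) * (e + f) = e + f"
    using assms by (simp add: algebra_simps)
  have "mod_iso (pmod (e + f)) (dsum 1 (pmod e) (pmod f))"
  proof (rule mod_isoI [where f = "\<lambda>v. vapp 1 (lmul e v) (lmul f v)"
        and g = "\<lambda>v. vadd (vtake 1 v) (vdrop 1 v)"])
    show "rlin (pmod (e + f)) (\<lambda>v. vapp 1 (lmul e v) (lmul f v))"
      using rlin_lmul unfolding rlin_def by (metis vapp_hom)
    show "(\<lambda>v. vapp 1 (lmul e v) (lmul f v)) \<in> pmod (e + f) \<rightarrow> dsum 1 (pmod e) (pmod f)"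
      using e f by (simp add: mem_dsum [OF pmod_vecs] vtake_vapp lmul_in_pmod)
    have "(e + f) * x = x" if "e * x = x" for x
      using that ef by (simp add: distrib_right) (metis mult.assoc mult_zero_left)
    moreover have "(e + f) * x = x" if "f * x = x" for x
      using that ef by (simp add: distrib_right) (metis mult.assoc mult_zero_left)
    ultimately have "vadd s t \<in> pmod (e + f)" if "s \<in> pmod e" "t \<in> pmod f" for s t
      using that by (simp add: pmod_def vadd_vecs) (simp add: vadd_def distrib_left)
    then show "(\<lambda>v. vadd (vtake 1 v) (vdrop 1 v)) \<in> dsum 1 (pmod e) (pmod f) \<rightarrow> pmod (e + f)"
      by (simp add: mem_dsum [OF pmod_vecs])
    show "vadd (vtake 1 (vapp 1 (lmul e v) (lmul f v))) (vdrop 1 (vapp 1 (lmul e v) (lmul f v))) = v"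
      if "v \<in> pmod (e + f)" for v
      using that by (simp add: vtake_vapp lmul_pmod flip: lmul_add_left)
    fix u assume "u \<in> dsum 1 (pmod e) (pmod f)"
    then have u: "vtake 1 u \<in> pmod e" "vdrop 1 u \<in> pmod f" by (simp_all add: mem_dsum [OF pmod_vecs])
    let ?s = "vtake 1 u" and ?t = "vdrop 1 u"
    have "e * ?t 0 = (e * f) * ?t 0" "f * ?s 0 = (f * e) * ?s 0"
      using u by (simp_all add: pmod_def mult.assoc)
    then have z: "lmul e ?t = vzero" "lmul f ?s = vzero"
      by (simp_all add: ef lmul_def single_def vzero_def)
    have "lmul e (vadd ?s ?t) = ?s" "lmul f (vadd ?s ?t) = ?t"
      using u z by (simp_all add: rlin_add [OF rlin_lmul [of UNIV]] lmul_pmod)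
        (simp_all add: vadd_def vzero_def)
    then show "vapp 1 (lmul e (vadd ?s ?t)) (lmul f (vadd ?s ?t)) = u" by simp
  qed
  then show ?thesis
    unfolding vcls_add [OF fg_proj_pmod [OF e] fg_proj_pmod [OF f]]
    using vcls_eq_iff [OF fg_proj_pmod [OF idem] fg_proj_dsum [OF fg_proj_pmod [OF e] fg_proj_pmod [OF f]]]
    by blast
qed

text \<open>Left multiplication by a generator \<open>x * k * y\<close> factors through k R as
  \<open>k * y\<close> followed by \<open>x\<close>. A sum of two maps factors through the direct
  sum of the two intermediate modules.\<close>

lemma ideal_gen_factors_through_sum:
  fixes k p :: "'a::ring_1"
  assumes "p \<in> ideal_gen {k}" and k: "k * k = k"
  shows "\<exists>N n C f g. fg_proj n C \<and> vcls n C = sum_list (replicate N (idem_class k))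
    \<and> rlin (vecs 1) f \<and> f \<in> vecs 1 \<rightarrow> C \<and> rlin C g \<and> g \<in> C \<rightarrow> vecs 1
    \<and> (\<forall>v\<in>vecs 1. g (f v) = lmul p v)"
  using assms(1)
proof induction
  case zero
  have "rlin A (\<lambda>x. vzero)" for A :: "(nat \<Rightarrow> 'a) set"
    by (simp add: rlin_def vzero_def vadd_def rsmul_def)
  moreover have "(vzero :: nat \<Rightarrow> 'a) \<in> vecs n" for n
    by (simp add: vzero_def vecs_def)
  moreover have "lmul 0 v = vzero" for v :: "nat \<Rightarrow> 'a"
    by (simp add: lmul_def single_def vzero_def)
  ultimately show ?case
    by (intro exI [of _ 0] exI [of _ "vecs 0"] exI [of _ "\<lambda>x. vzero"])
      (simp add: fg_proj_vecs_self vcls_0 Pi_iff)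
next
  case (gen s x y)
  then have [simp]: "s = k" by simp
  have "vcls 1 (pmod k) = sum_list (replicate 1 (idem_class k))"
    by (simp add: One_nat_def)
  moreover have "lmul (k * y) \<in> vecs 1 \<rightarrow> pmod k"
    using k by (auto intro!: lmul_in_pmod simp flip: mult.assoc)
  moreover have "lmul x (lmul (k * y) v) = lmul (x * s * y) v" for v by (simp add: mult.assoc)
  ultimately show ?case
    using fg_proj_pmod [OF k] rlin_lmul lmul_vecs by (metis Pi_I)
next
  case (add p q)
  then obtain N n C f g M m D f' g' where
    C: "fg_proj n C" "vcls n C = sum_list (replicate N (idem_class k))"
      "rlin (vecs 1) f" "f \<in> vecs 1 \<rightarrow> C" "rlin C g" "g \<in> C \<rightarrow> vecs 1"
      "\<forall>v\<in>vecs 1. g (f v) = lmul p v" and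
    D: "fg_proj m D" "vcls m D = sum_list (replicate M (idem_class k))"
      "rlin (vecs 1) f'" "f' \<in> vecs 1 \<rightarrow> D" "rlin D g'" "g' \<in> D \<rightarrow> vecs 1"
      "\<forall>v\<in>vecs 1. g' (f' v) = lmul q v"
    by blast
  note Cvec = fg_proj_vecs [OF C(1)]
  have t: "vtake n (vapp n (f v) w) = f v" if "v \<in> vecs 1" for v w
    using that C(4) Cvec by (auto intro!: vtake_vapp)
  \<comment> \<open>The diagonal map into the direct sum, followed by the sum of the two outgoing
    maps.\<close>
  let ?f = "\<lambda>v. vapp n (f v) (f' v)" and ?g = "\<lambda>v. vadd (g (vtake n v)) (g' (vdrop n v))"
  have "vcls (n + m) (dsum n C D) = sum_list (replicate (N + M) (idem_class k))"
    using C(1,2) D(1,2) by (simp add: replicate_add flip: vcls_add)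
  moreover have "rlin (vecs 1) ?f"
    using C(3) D(3) by (simp add: rlin_def vapp_hom)
  moreover have "?f \<in> vecs 1 \<rightarrow> dsum n C D"
    using C(4) D(4) by (auto simp: mem_dsum [OF Cvec] t)
  moreover have "rlin (dsum n C D) ?g"
  proof (rule rlin_vadd)
    show "rlin (dsum n C D) (\<lambda>v. g (vtake n v))"
      by (rule rlin_comp [OF _ _ C(5)]) (auto simp: rlin_def vtake_hom mem_dsum [OF Cvec])
    show "rlin (dsum n C D) (\<lambda>v. g' (vdrop n v))"
      by (rule rlin_comp [OF _ _ D(5)]) (auto simp: rlin_def vdrop_hom mem_dsum [OF Cvec])
  qed
  moreover have "?g \<in> dsum n C D \<rightarrow> vecs 1"
    using C(6) D(6) by (auto simp: mem_dsum [OF Cvec] intro!: vadd_vecs)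
  moreover have "\<forall>v\<in>vecs 1. ?g (?f v) = lmul (p + q) v"
    using C(7) D(7) by (simp add: t lmul_add_left)
  ultimately show ?case using fg_proj_dsum [OF C(1) D(1)] by blast
qed

text \<open>On p R, left multiplication by \<open>p\<close> is the identity, and it factors through
  a multiple of k R. Following \<open>g\<close> by another multiplication by \<open>p\<close> makes
  it land in p R, so p R is a retract of that multiple.\<close>

lemma idem_class_le_multiple:
  fixes k p :: "'a::ring_1"
  assumes "p \<in> ideal_gen {k}" and k: "k * k = k" and p: "p * p = p"
  shows "\<exists>N d. idem_class p + d = sum_list (replicate N (idem_class k))"
proof -
  obtain N n C f g where
    C: "fg_proj n C" "vcls n C = sum_list (replicate N (idem_class k))"
      "rlin (vecs 1) f" "f \<in> vecs 1 \<rightarrow> C" "rlin C g" "g \<in> C \<rightarrow> vecs 1"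
      "\<forall>v\<in>vecs 1. g (f v) = lmul p v"
    using ideal_gen_factors_through_sum [OF assms(1) k] by blast
  have "\<exists>d. vcls 1 (pmod p) + d = vcls n C"
  proof (rule vcls_retract)
    show "rlin (pmod p) f" using C(3) pmod_vecs by (rule rlin_subset)
    show "f \<in> pmod p \<rightarrow> C" using C(4) pmod_vecs by blast
    show "rlin C (\<lambda>v. lmul p (g v))" using C(5,6) rlin_lmul by (rule rlin_comp)
    show "(\<lambda>v. lmul p (g v)) \<in> C \<rightarrow> pmod p" using p by (simp add: lmul_in_pmod)
    show "lmul p (g (f x)) = x" if "x \<in> pmod p" for x
      using that C(7) pmod_vecs [of p] p by (auto simp: lmul_pmod)
  qed (use C fg_proj_pmod p in auto)
  with C(2) show ?thesis by auto
qed

text \<open>Converse of \<open>idem_class_eqI\<close>: a linear map from e R is left multiplication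
  by its value at \<open>e\<close>, so an isomorphism and its inverse are given by two ring
  elements.\<close>

lemma idem_class_eqE:
  fixes e f :: "'a::ring_1"
  assumes "idem_class e = idem_class f" "e * e = e" "f * f = f"
  obtains x y where "y * x = e" "x * y = f" "f * x * e = x" "e * y * f = y"
proof -
  have "mod_iso (pmod e) (pmod f)" and e: "rsubmod 1 (pmod e)"
    using assms by (simp_all add: vcls_eq_iff fg_proj_pmod fg_proj_rsubmod)
  then obtain h g where h: "rlin (pmod e) h" "h \<in> pmod e \<rightarrow> pmod f"
    and g: "rlin (pmod f) g" "g \<in> pmod f \<rightarrow> pmod e"
    and gh: "\<And>x. x \<in> pmod e \<Longrightarrow> g (h x) = x" and hg: "\<And>y. y \<in> pmod f \<Longrightarrow> h (g y) = y"
    by (rule mod_isoE) blast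
  have se: "single e \<in> pmod e" and sf: "single f \<in> pmod f" using assms by (simp_all add: pmod_def)
  \<comment> \<open>Every \<open>v\<close> in u R is the generator \<open>single u\<close> times the
    scalar \<open>v 0\<close>, so linearity determines \<open>k v\<close>.\<close>
  have rep: "k v 0 = k (single u) 0 * v 0" if "rlin (pmod u) k" "u * u = u" "v \<in> pmod u" for k v and u :: 'a
  proof -
    have "v = rsmul (single u) (v 0)"
      using that(3) by (auto simp: pmod_def rsmul_def single_def vecs_def fun_eq_iff)
    moreover have "single u \<in> pmod u" using that(2) by (simp add: pmod_def)
    ultimately have "k v = rsmul (k (single u)) (v 0)" using rlin_smul [OF that(1)] by metis
    then show ?thesis by (simp add: rsmul_def)
  qed
  define x where "x = h (single e) 0"
  define y where "y = g (single f) 0"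
  have "y * x = g (h (single e)) 0" "x * y = h (g (single f)) 0"
    using rep [OF g(1) assms(3), of "h (single e)"] rep [OF h(1) assms(2), of "g (single f)"] h(2) g(2) se sf
    by (simp_all add: x_def y_def Pi_iff)
  then have "y * x = e" "x * y = f" using gh [OF se] hg [OF sf] by simp_all
  moreover have "f * x = x" "e * y = y"
    using funcset_mem [OF h(2) se] funcset_mem [OF g(2) sf] by (simp_all add: x_def y_def pmod_def)
  moreover have "x * e = x" "y * f = y"
    using rep [OF h(1) assms(2) se] rep [OF g(1) assms(3) sf] by (simp_all add: x_def y_def)
  ultimately show thesis using that by metis
qed

lemma ideal_gen_mono:
  assumes "x \<in> ideal_gen S" "\<And>s. s \<in> S \<Longrightarrow> \<exists>u t v. t \<in> T \<and> s = u * t * v"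
  shows "x \<in> ideal_gen T"
  using assms(1)
proof induction
  case (gen s x y)
  obtain u t v where "t \<in> T" "s = u * t * v" using assms(2) [OF gen] by blast
  then have "x * s * y = (x * u) * t * (v * y)" by (simp add: mult.assoc)
  then show ?case using ideal_gen.gen [OF \<open>t \<in> T\<close>] by simp
qed (auto intro: ideal_gen.intros)

section \<open>Unit-regularity\<close>

text \<open>Here (1 - z a) R is r(a), and (1 - a z) R is a complement of a R. Adding to
  \<open>a\<close> an isomorphism \<open>x\<close> from the first onto the second yields a unit,
  whose inverse serves as the unit in the definition of unit-regularity.\<close>

lemma unit_regular_if_idem_class_eq:
  fixes a z :: "'a::ring_1"
  assumes aza: "a * z * a = a"
    and eq: "idem_class (1 - z * a) = idem_class (1 - a * z)"
  shows "unit_regular a"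
proof -
  define k m where "k = 1 - z * a" and "m = 1 - a * z"
  have ak: "a * k = 0" and ma: "m * a = 0"
    using aza by (simp_all add: k_def m_def algebra_simps)
  have kk: "k * k = k" and mm: "m * m = m"
  proof -
    have "k * k = k - z * (a * k)" by (subst k_def) (simp add: algebra_simps)
    then show "k * k = k" using ak by simp
    have "m * m = m - m * a * z" by (subst (2) m_def) (simp add: algebra_simps)
    then show "m * m = m" using ma by simp
  qed
  obtain x y where yx: "y * x = k" and xy: "x * y = m" and x: "m * x * k = x" and y: "k * y * m = y"
    using idem_class_eqE [OF eq [folded k_def m_def] kk mm] by blast
  \<comment> \<open>Passing from \<open>z\<close> to \<open>z * a * z\<close> ensures
    \<open>w * m = 0\<close> and \<open>k * w = 0\<close>, so that the cross terms
    \<open>w * x\<close> and \<open>x * w\<close> vanish.\<close>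
  define w where "w = z * a * z"
  have "w * a = z * (a * z * a)" "a * w = (a * z * a) * z" by (simp_all add: w_def mult.assoc)
  then have wa: "w * a = 1 - k" and aw: "a * w = 1 - m" by (simp_all add: aza k_def m_def)
  have ay: "a * y = 0" and ya: "y * a = 0"
    using y ak ma by (metis mult.assoc mult_zero_left mult_zero_right)+
  have "w * m = z * (a * z - (a * z * a) * z)" "k * w = (z * a - z * (a * z * a)) * z"
    by (simp_all add: w_def k_def m_def left_diff_distrib right_diff_distrib mult.assoc)
  then have "w * m = 0" "k * w = 0" by (simp_all add: aza)
  then have wx: "w * x = 0" and xw: "x * w = 0"
    using x by (metis mult.assoc mult_zero_left mult_zero_right)+
  have "(w + y) * (a + x) = 1" "(a + x) * (w + y) = 1"
    by (simp_all add: distrib_left distrib_right wa aw ay ya wx xw yx xy)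
  then have "is_unit (w + y)" by (auto simp: is_unit_def)
  moreover have "a = a * (w + y) * a"
    using ay aw ma by (simp add: distrib_left left_diff_distrib)
  ultimately show ?thesis by (auto simp: unit_regular_def)
qed

text \<open>Replacing a quasi-inverse \<open>y\<close> by \<open>y * x * y\<close> secures the
  second equation as well.\<close>

lemma regular_eltE:
  assumes "regular_elt x"
  obtains y where "x * y * x = x" "y * x * y = y"
proof -
  obtain y where y: "x * y * x = x" using assms unfolding regular_elt_def by metis
  have "x * (y * x * y) * x = x" "(y * x * y) * x * (y * x * y) = y * x * y"
    using y by (metis mult.assoc)+
  then show thesis by (rule that)
qed

text \<open>As \<open>c\<close> commutes with \<open>a\<close>, the equation
  \<open>b * y * b = b\<close> reads \<open>a * (c * y * c) * a = a - a * a * a\<close>, which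
  explains the choice of \<open>z\<close>. For the second claim, each side is realised as the class
  of a sum of two orthogonal idempotents.\<close>

lemma idem_class_ker_coker:
  fixes a c b y :: "'a::ring_1"
  assumes c: "c = 1 - a * a" and b: "b = a * c" and byb: "b * y * b = b" and yby: "y * b * y = y"
  defines "z \<equiv> a + c * y * c"
  shows "a * z * a = a"
    and "idem_class (1 - z * a) + idem_class (b * y) = idem_class (1 - a * z) + idem_class (b * y)"
proof -
  \<comment> \<open>\<open>k\<close> and \<open>m\<close> are \<open>1 - z * a\<close> and
    \<open>1 - a * z\<close>, written so that both visibly lie in c R. As \<open>w\<close> is
    \<open>(c * y) * a\<close> and \<open>v\<close> is \<open>a * (c * y)\<close>, left
    multiplication by \<open>a\<close> carries w R isomorphically onto v R = b R.\<close>
  define k m v w where "k = c - c * y * b" and "m = c - b * y * c" and "v = b * y" and "w = c * y * a"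
  have ca: "c * a = b" and aa: "a * a = 1 - c" by (simp_all add: c b algebra_simps)
  have cb: "c * b = b * c" by (simp add: b c algebra_simps)
  have k: "1 - z * a = k" and m: "1 - a * z = m"
    by (simp_all add: z_def k_def m_def distrib_left distrib_right aa mult.assoc ca)
      (simp_all add: b flip: mult.assoc)
  have ak: "a * k = 0" and ma: "m * a = 0"
    using byb by (simp_all add: k_def m_def right_diff_distrib left_diff_distrib b ca mult.assoc)
  from ma show aza: "a * z * a = a" by (simp add: left_diff_distrib flip: m)
  have kk: "k * k = k" and mm: "m * m = m"
  proof -
    have "k * k = k - z * (a * k)" by (subst k [symmetric]) (simp add: left_diff_distrib mult.assoc)
    then show "k * k = k" using ak by simp
    have "m * m = m - (m * a) * z" by (subst (2) m [symmetric]) (simp add: right_diff_distrib mult.assoc)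
    then show "m * m = m" using ma by simp
  qed
  have vv: "v * v = v" using byb by (simp add: v_def flip: mult.assoc)
  have ww: "w * w = w"
  proof -
    have "w * w = c * (y * (a * c) * y) * a" by (simp add: w_def mult.assoc)
    then show ?thesis by (simp only: b [symmetric] yby) (simp add: w_def)
  qed
  have wk: "w * k = 0"
    using ak by (simp add: w_def mult.assoc)
  have mv: "m * v = 0" using ma by (simp add: v_def b flip: mult.assoc)
  have vm: "v * m = 0"
    using byb by (simp add: v_def m_def right_diff_distrib flip: mult.assoc)
  txt \<open>Modify \<open>k\<close> to an idempotent with the same image that is also orthogonal to \<open>w\<close> on the left.\<close>
  define k' where "k' = k - k * w"
  have k'k: "k' * k = k" and kk': "k * k' = k'"
    using kk wk by (simp_all add: k'_def left_diff_distrib right_diff_distrib mult.assoc)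
      (simp_all flip: mult.assoc)
  have k'k': "k' * k' = k'" using k'k kk' by (metis mult.assoc)
  have k'w: "k' * w = 0" and wk': "w * k' = 0"
    using ww wk by (simp_all add: k'_def left_diff_distrib right_diff_distrib mult.assoc)
      (simp flip: mult.assoc)
  have "idem_class k = idem_class k'"
    using idem_class_eqI [of k' k] k'k kk' kk k'k' by simp
  moreover have "idem_class w = idem_class v"
    using idem_class_eqI [of "c * y" a] ww vv by (simp add: w_def v_def b flip: mult.assoc)
  ultimately have 1: "idem_class k + idem_class v = idem_class (k' + w)"
    using idem_class_add [OF k'k' ww k'w wk'] by simp
  have 2: "idem_class m + idem_class v = idem_class (m + v)"
    using idem_class_add [OF mm vv mv vm] by simp
  let ?g = "k' + w" and ?h = "m + v"
  txt \<open>Both \<open>?g\<close> and \<open>?h\<close> are idempotents with image \<open>c R\<close>.\<close>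
  have gc: "?g * c = c"
  proof -
    have wc: "w * c = c * y * b" by (simp add: w_def b mult.assoc)
    \<comment> \<open>This uses \<open>?g = 1 - (1 - k) * (1 - w)\<close>. Since
      \<open>1 - k = z * a\<close>, the error term vanishes because
      \<open>a * (c - w * c) = b - b * y * b\<close>.\<close>
    have "?g * c = c - (1 - k) * (c - w * c)" by (simp add: k'_def algebra_simps)
    also have "(1 - k) * (c - w * c) = z * (a * c - a * c * y * b)"
      by (subst k [symmetric]) (simp add: wc right_diff_distrib mult.assoc)
    also have "\<dots> = 0" using byb by (simp flip: b)
    finally show ?thesis by simp
  qed
  have hc: "?h * c = c"
  proof -
    have "?h * c = c * c + b * y * (c - c * c)" by (simp add: m_def v_def algebra_simps)
    also have "c - c * c = b * a" by (simp add: b c algebra_simps)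
    also have "b * y * (b * a) = b * a" using byb by (simp flip: mult.assoc)
    also have "c * c + b * a = c" by (simp add: b c algebra_simps)
    finally show ?thesis .
  qed
  \<comment> \<open>Pull \<open>c\<close> out of \<open>k = c * (1 - y * b)\<close> and
    \<open>w = c * (y * a)\<close>. The witness for \<open>?h\<close> arises in the same way from
    \<open>b = c * a\<close>.\<close>
  have "\<exists>s. ?g = c * s"
    by (rule exI [of _ "1 - y * b - (1 - y * b) * w + y * a"])
      (simp add: k'_def k_def w_def algebra_simps)
  then obtain s where s: "?g = c * s" by blast
  have "\<exists>t. ?h = c * t"
    by (rule exI [of _ "1 - a * y * c + a * y"])
      (simp add: m_def v_def distrib_left right_diff_distrib ca flip: mult.assoc)
  then obtain t where t: "?h = c * t" by blast
  \<comment> \<open>Each of \<open>?g\<close> and \<open>?h\<close> lies in c R and fixes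
    \<open>c\<close> from the left, so each fixes the other and itself.\<close>
  have hg: "?h * ?g = ?g" using hc s by (metis mult.assoc)
  have gh: "?g * ?h = ?h" using gc t by (metis mult.assoc)
  have "?g * ?g = ?g" using gc s by (metis mult.assoc)
  moreover have "?h * ?h = ?h" using hc t by (metis mult.assoc)
  ultimately have "idem_class ?g = idem_class ?h"
    using idem_class_eqI [of ?h ?g] unfolding hg gh by simp
  with 1 2 show "idem_class (1 - z * a) + idem_class (b * y) = idem_class (1 - a * z) + idem_class (b * y)"
    by (simp add: k m flip: v_def)
qed

theorem theorem2p5:
  fixes a :: "'a::ring_1"
  assumes "separative TYPE('a)"
    and "exchange_ring TYPE('a)"
    and "is_unit (2::'a)"
    and "regular_elt (a - a ^ 3)"
    and "ideal_gen {1 - a ^ 2} \<inter> ideal_gen {a}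
           = ideal_gen (rann a) \<inter> ideal_gen (lann a) \<inter> ideal_gen {a}"
  shows "unit_regular a"
proof -
  define c where "c = 1 - a * a"
  define b where "b = a * c"
  have "a - a ^ 3 = b" by (simp add: b_def c_def power3_eq_cube algebra_simps)
  then obtain y where byb: "b * y * b = b" and yby: "y * b * y = y"
    using assms(4) by (auto elim: regular_eltE)
  define z where "z = a + c * y * c"
  note ker_coker = idem_class_ker_coker [OF c_def b_def byb yby, folded z_def]
  note aza = ker_coker(1)
  let ?k = "1 - z * a" and ?m = "1 - a * z"
  have zaza: "z * (a * (z * a)) = z * a" "a * (z * (a * z)) = a * z"
    using aza by (metis mult.assoc)+
  then have kk: "?k * ?k = ?k" and mm: "?m * ?m = ?m"
    by (simp_all add: algebra_simps)
  have vv: "(b * y) * (b * y) = b * y" using byb by (simp flip: mult.assoc)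
  \<comment> \<open>The idempotent \<open>b * y\<close> generates b R, the module to be cancelled.
    Membership in both ideals on the left of the hypothesis transfers to the ideals of the two
    annihilators.\<close>
  have "b * y = a * (1 - a ^ 2) * y" by (simp add: b_def c_def power2_eq_square)
  then have "b * y \<in> ideal_gen {1 - a ^ 2}"
    using ideal_gen.gen [of "1 - a ^ 2" "{1 - a ^ 2}" a y] by simp
  moreover have "b * y = 1 * a * (c * y)" by (simp add: b_def mult.assoc)
  then have "b * y \<in> ideal_gen {a}"
    using ideal_gen.gen [of a "{a}" 1 "c * y"] by simp
  ultimately have v: "b * y \<in> ideal_gen (rann a)" "b * y \<in> ideal_gen (lann a)"
    using assms(5) by blast+
  \<comment> \<open>The idempotent \<open>?k\<close> fixes r(a) from the left, so it generates an
    ideal containing R r(a). Likewise \<open>?m\<close> fixes the left annihilator from the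
    right.\<close>
  have "s = 1 * ?k * s" if "s \<in> rann a" for s
    using that by (simp add: rann_def left_diff_distrib mult.assoc)
  then have "b * y \<in> ideal_gen {?k}" by (intro ideal_gen_mono [OF v(1)]) blast
  then obtain n d where nd: "idem_class (b * y) + d = sum_list (replicate n (idem_class ?k))"
    using idem_class_le_multiple kk vv by blast
  have "s = s * ?m * 1" if "s \<in> lann a" for s
    using that by (simp add: lann_def right_diff_distrib flip: mult.assoc)
  then have "b * y \<in> ideal_gen {?m}" by (intro ideal_gen_mono [OF v(2)]) blast
  then obtain n' d' where nd': "idem_class (b * y) + d' = sum_list (replicate n' (idem_class ?m))"
    using idem_class_le_multiple mm vv by blast
  \<comment> \<open>The class of \<open>b * y\<close> is cancelled from the identity
    \<open>ker_coker(2)\<close>, being a summand of a multiple of either side.\<close>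
  have "idem_class ?k = idem_class ?m"
    using separative_proj_class [OF assms(1)] ker_coker(2) nd nd' by (rule separative_cancel)
  with aza show ?thesis by (rule unit_regular_if_idem_class_eq)
qed

end
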